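(* Let $g:\mathcal{P}\to\mathbb{R}$ with $g(\boldsymbol{x})=\sum_{k=1}^q g_k(\boldsymbol{x}_{H_k})$, where each $g_k$ is a (possibly non-separable) function of the variables with indices in $H_k\subseteq[n]$. Let $C\subseteq[n]$ and $I=[n]\setminus C$ be the index sets of continuous and integer variables, and $\mathcal{P}=\prod_{i=1}^n\mathcal{P}_i$ with $\mathcal{P}_i=[\mathcal{P}_i\!\downarrow,\mathcal{P}_i\!\uparrow]$ for $i\in C$ and $\mathcal{P}_i=[\mathcal{P}_i\!\downarrow,\mathcal{P}_i\!\uparrow]\cap\mathbb{Z}$ for $i\in I$. Let $b\in\mathbb{R}$. Let $\{\mathcal{P}^j\}_{j\in\mathbb{N}}$ be a nested sequence of boxes $\mathcal{P}^j=\prod_{i=1}^n\mathcal{P}^j_i\subseteq\mathcal{P}$, $\mathcal{P}^j\supseteq\mathcal{P}^{j+1}$ for all $j$, converging in the Hausdorff sense to a singleton $\{\tilde{\boldsymbol{x}}\}$, where $\tilde{\boldsymbol{x}}\in\mathbb{R}^n$ with $\tilde{x}_i\in\mathbb{Z}$ for $i\in I$. For $j\in\mathbb{N}$ let $\mathcal{F}^j=\{\boldsymbol{x}\in\mathcal{P}^j\mid g(\boldsymbol{x})\le b\}$, and let $\mathtt{D}^j$ be the decision diagram for $\mathcal{F}^j$ constructed by the relaxed-DD procedure (with or without merging, see context) with the single sub-domain partition $\mathcal{P}^j_i$ for each $i\in[n]$, using for each $k\in[q]$ a lower bound calculation rule that is convergent with respect to $g_k$ over $\prod_{l\in H_k}\mathcal{P}_l$.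 Then: (i) If $g(\tilde{\boldsymbol{x}})\le b$, then $\{\mathrm{conv}(\mathrm{Sol}(\mathtt{D}^j))\}_{j}$ is a nested sequence converging in the Hausdorff sense to $\{\tilde{\boldsymbol{x}}\}$. (ii) If $g(\tilde{\boldsymbol{x}})>b$, then there exists $m\in\mathbb{N}$ such that $\mathrm{Sol}(\mathtt{D}^j)=\emptyset$ for all $j\ge m$.
   Context: Notation: $[n]=\{1,\dots,n\}$; $\boldsymbol{x}_H$ is the sub-vector with indices in $H$; each $H_k$ is nonempty and $H_k^{\max}=\max_{l\in H_k}l$. A box contained in $\mathcal{P}$ (or in $\prod_{l\in H_k}\mathcal{P}_l$) means a nonempty product of sets $[\ell_i,u_i]$ for $i\in C$ and $[\ell_i,u_i]\cap\mathbb{Z}$, with integer $\ell_i\le u_i$, for $i\in I$; $\downarrow$ and $\uparrow$ denote the lower and upper endpoints of a factor. All domains are bounded. Lower bound calculation rule: for a function $h:\mathcal{D}\to\mathbb{R}$ on a box $\mathcal{D}$, it assigns to each box $\bar{\mathcal{D}}\subseteq\mathcal{D}$ a real number $\eta(\bar{\mathcal{D}})$ with $\eta(\bar{\mathcal{D}})\le h(\boldsymbol{x})$ for all $\boldsymbol{x}\in\bar{\mathcal{D}}$. It is consistent with respect to $h$ over $\mathcal{D}$ if $\eta(\mathcal{D}^1)\ge\eta(\mathcal{D}^2)$ whenever $\mathcal{D}^1\subseteq\mathcal{D}^2\subseteq\mathcal{D}$. It is convergent with respect to $h$ over $\mathcal{D}$ if it is consistent and $\lim_{j\to\infty}\eta(\mathcal{D}^j)=h(\bar{\boldsymbol{x}})$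 for every nested sequence of boxes $\mathcal{D}^j\subseteq\mathcal{D}$ converging in the Hausdorff sense to a singleton $\{\bar{\boldsymbol{x}}\}$. Decision diagram (DD): a directed acyclic multigraph $\mathtt{D}=(\mathtt{U},\mathtt{A},\mathtt{l}(\cdot))$ with node layers $\mathtt{U}_1,\dots,\mathtt{U}_{n+1}$, where $\mathtt{U}_1=\{\mathtt{r}\}$ (root) and $\mathtt{U}_{n+1}=\{\mathtt{t}\}$ (terminal), and arc layers $\mathtt{A}_1,\dots,\mathtt{A}_n$; each arc in $\mathtt{A}_i$ goes from $\mathtt{U}_i$ to $\mathtt{U}_{i+1}$ and has a real label. $\mathrm{Sol}(\mathtt{D})\subseteq\mathbb{R}^n$ is the set of points $(\mathtt{l}(\mathtt{a}_1),\dots,\mathtt{l}(\mathtt{a}_n))$ over all $\mathtt{r}$-$\mathtt{t}$ paths $(\mathtt{a}_1,\dots,\mathtt{a}_n)$. Relaxed-DD procedure for a box $\mathcal{Q}=\prod_i\mathcal{Q}_i$ with a single sub-domain partition $\mathcal{Q}_i$ per variable. Set $\mathtt{s}(\mathtt{r})=0$. For $i=1,\dots,n$ in order, for each node $\mathtt{u}\in\mathtt{U}_i$: for each $k\in[q]$, if $i=H_k^{\max}$, let $\eta_k$ be the value of the lower bound calculation rule for $g_k$ on the box given by $x_i\in\mathcal{Q}_i$ and $x_l\in\mathcal{D}_l(\mathtt{u})$, $l\in H_k\setminus\{i\}$; otherwise $\eta_k=0$. Put $\xi=\mathtt{s}(\mathtt{u})+\sum_{k}\eta_k$. If $i<n$,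 create in $\mathtt{U}_{i+1}$ a node $\mathtt{v}$ with state value $\mathtt{s}(\mathtt{v})=\xi$ (if it does not already exist) and add two arcs from $\mathtt{u}$ to $\mathtt{v}$ labelled $\mathcal{Q}_i\!\downarrow$ and $\mathcal{Q}_i\!\uparrow$. If $i=n$ and $\xi\le b$, add two arcs from $\mathtt{u}$ to $\mathtt{t}$ labelled $\mathcal{Q}_n\!\downarrow$ and $\mathcal{Q}_n\!\uparrow$. Here $\mathcal{D}_l(\mathtt{u})$ is the range from the minimum to the maximum label of arcs in layer $l$ lying on a path from $\mathtt{r}$ to $\mathtt{u}$ (restricted to integers when $l\in I$). In the version with merging, after layer $i+1\le n$ is created, subsets of its nodes may be merged into single nodes (inheriting incoming arcs and taking the minimum state value) so that the layer has at most $\omega\ge1$ nodes; with a single sub-domain partition per variable each layer $\mathtt{U}_i$, $i \le n$, has exactly one node, so both versions give the same diagram and $\mathcal{D}_l(\mathtt{u})=\mathcal{Q}_l$. *)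

theory Defs
  imports "HOL-Analysis.Analysis" "HOL-Library.Multiset" "HOL-Library.Disjoint_Sets"
begin

text \<open>
  Points of R^n are elements of \<open>real ^ 'n\<close>, where the finite linearly ordered type \<open>'n\<close>
  plays the role of [n] and \<open>CARD('n)\<close> that of n; \<open>var_index\<close> is the position of an index in
  1, ..., n. The set \<open>C\<close> collects the continuous indices;
  all other indices are integer.
\<close>

type_synonym 'n pt = "(real, 'n) vec"

definition var_index :: "'n::{finite,linorder} \<Rightarrow> nat" where
  "var_index v = card {..v}"

text \<open>
  The space of vectors with index set \<open>H\<close> is identified (isometrically) with the coordinate
  subspace of \<open>real ^ 'n\<close> of vectors vanishing outside \<open>H\<close>.
\<close>

definition subvec :: "'n::finite set \<Rightarrow> 'n pt \<Rightarrow> 'n pt" where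
  "subvec H x = (\<chi> i. if i \<in> H then x $ i else 0)"

definition set_prod :: "'n::finite set \<Rightarrow> ('n \<Rightarrow> real set) \<Rightarrow> 'n pt set" where
  "set_prod H S = {x. (\<forall>i\<in>H. x $ i \<in> S i) \<and> (\<forall>i. i \<notin> H \<longrightarrow> x $ i = 0)}"

definition var_range :: "'n set \<Rightarrow> 'n \<Rightarrow> real \<Rightarrow> real \<Rightarrow> real set" where
  "var_range C i a b = (if i \<in> C then {a..b} else {a..b} \<inter> \<int>)"

definition range_prod :: "'n::finite set \<Rightarrow> 'n set \<Rightarrow> 'n pt \<Rightarrow> 'n pt \<Rightarrow> 'n pt set" where
  "range_prod C H lo hi = set_prod H (\<lambda>i. var_range C i (lo $ i) (hi $ i))"

definition box_bounds :: "'n::finite set \<Rightarrow> 'n set \<Rightarrow> 'n pt \<Rightarrow> 'n pt \<Rightarrow> bool" where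
  "box_bounds C H lo hi \<longleftrightarrow>
     (\<forall>i\<in>H. lo $ i \<le> hi $ i) \<and> (\<forall>i\<in>H - C. lo $ i \<in> \<int> \<and> hi $ i \<in> \<int>)"

definition is_box :: "'n::finite set \<Rightarrow> 'n set \<Rightarrow> 'n pt set \<Rightarrow> bool" where
  "is_box C H B \<longleftrightarrow> (\<exists>lo hi. box_bounds C H lo hi \<and> B = range_prod C H lo hi)"

text \<open>
  The distance is extended-real valued, so that a nonempty set has distance infinity from the
  empty set; in particular the empty set is not close to a singleton.
\<close>

definition hausdorff_dist :: "'a::metric_space set \<Rightarrow> 'a set \<Rightarrow> ennreal" where
  "hausdorff_dist A B =
     max (SUP a\<in>A. INF b\<in>B. ennreal (dist a b)) (SUP b\<in>B. INF a\<in>A. ennreal (dist a b))"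

definition hausdorff_converges :: "(nat \<Rightarrow> 'a::metric_space set) \<Rightarrow> 'a set \<Rightarrow> bool" where
  "hausdorff_converges S L \<longleftrightarrow> (\<lambda>j. hausdorff_dist (S j) L) \<longlonglongrightarrow> 0"

definition nested_seq :: "(nat \<Rightarrow> 'a set) \<Rightarrow> bool" where
  "nested_seq S \<longleftrightarrow> (\<forall>j. S (Suc j) \<subseteq> S j)"

definition lower_bound_rule ::
  "'n::finite set \<Rightarrow> 'n set \<Rightarrow> ('n pt \<Rightarrow> real) \<Rightarrow> 'n pt set \<Rightarrow>
   ('n pt set \<Rightarrow> real) \<Rightarrow> bool" where
  "lower_bound_rule C H h D \<eta> \<longleftrightarrow>
     (\<forall>B. is_box C H B \<and> B \<subseteq> D \<longrightarrow> (\<forall>x\<in>B. \<eta> B \<le> h x))"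

definition consistent_rule ::
  "'n::finite set \<Rightarrow> 'n set \<Rightarrow> ('n pt \<Rightarrow> real) \<Rightarrow> 'n pt set \<Rightarrow>
   ('n pt set \<Rightarrow> real) \<Rightarrow> bool" where
  "consistent_rule C H h D \<eta> \<longleftrightarrow>
     lower_bound_rule C H h D \<eta> \<and>
     (\<forall>B1 B2. is_box C H B1 \<and> is_box C H B2 \<and> B1 \<subseteq> B2 \<and> B2 \<subseteq> D \<longrightarrow> \<eta> B1 \<ge> \<eta> B2)"

definition convergent_rule ::
  "'n::finite set \<Rightarrow> 'n set \<Rightarrow> ('n pt \<Rightarrow> real) \<Rightarrow> 'n pt set \<Rightarrow>
   ('n pt set \<Rightarrow> real) \<Rightarrow> bool" where
  "convergent_rule C H h D \<eta> \<longleftrightarrow>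
     consistent_rule C H h D \<eta> \<and>
     (\<forall>B x. (\<forall>j. is_box C H (B j) \<and> B j \<subseteq> D) \<and> nested_seq B \<and> hausdorff_converges B {x}
        \<longrightarrow> (\<lambda>j. \<eta> (B j)) \<longlonglongrightarrow> h x)"

text \<open>
  An arc is a triple (tail, label, head). The diagram is a multigraph, so each arc layer is a
  multiset: for a degenerate range the two arcs leaving a node carry the same label.
\<close>

type_synonym 'v arc = "'v \<times> real \<times> 'v"

record 'v dd =
  layer :: "nat \<Rightarrow> 'v set"
  arcs :: "nat \<Rightarrow> 'v arc multiset"

text \<open>Pairwise disjoint layers with arcs between consecutive layers make the digraph acyclic.\<close>

definition decision_diagram :: "nat \<Rightarrow> 'v dd \<Rightarrow> bool" where
  "decision_diagram n D \<longleftrightarrow>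
     (\<exists>r. layer D 1 = {r}) \<and> (\<exists>t. layer D (n + 1) = {t}) \<and>
     disjoint_family_on (layer D) {1..n + 1} \<and>
     (\<forall>i\<in>{1..n}. \<forall>(u, c, v) \<in># arcs D i. u \<in> layer D i \<and> v \<in> layer D (i + 1))"

fun dd_path :: "'v dd \<Rightarrow> nat \<Rightarrow> 'v \<Rightarrow> 'v arc list \<Rightarrow> 'v \<Rightarrow> bool" where
  "dd_path D i u [] v \<longleftrightarrow> u = v"
| "dd_path D i u ((a, c, a') # as) v \<longleftrightarrow>
     (a, c, a') \<in># arcs D i \<and> a = u \<and> dd_path D (Suc i) a' as v"

definition root_path :: "'v dd \<Rightarrow> 'v arc list \<Rightarrow> 'v \<Rightarrow> bool" where
  "root_path D as v \<longleftrightarrow> (\<exists>r\<in>layer D 1. dd_path D 1 r as v)"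

definition path_label :: "'v arc list \<Rightarrow> nat \<Rightarrow> real" where
  "path_label as i = fst (snd (as ! (i - 1)))"

definition Sol :: "'v dd \<Rightarrow> 'n::{finite,linorder} pt set" where
  "Sol D = {x. \<exists>as. \<exists>t\<in>layer D (CARD('n) + 1).
                 root_path D as t \<and> length as = CARD('n) \<and>
                 (\<forall>l. x $ l = path_label as (var_index l))}"

text \<open>The set \<open>node_range C D u l\<close> is the domain of variable \<open>l\<close> at node \<open>u\<close>.\<close>

definition node_range :: "'n set \<Rightarrow> 'v dd \<Rightarrow> 'v \<Rightarrow> 'n::{finite,linorder} \<Rightarrow> real set" where
  "node_range C D u l =
     (let L = {path_label as (var_index l) | as. root_path D as u \<and> var_index l \<le> length as}
      in var_range C l (Min L) (Max L))"

text \<open>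
  Within a layer there is at most one node per state value, so a non-terminal node is identified
  by its layer and its state value. This persists under merging, because distinct classes of
  merged nodes have distinct minimum state values.
\<close>

datatype dd_node = State_Node nat real | Terminal

primrec state :: "dd_node \<Rightarrow> real" where
  "state (State_Node i s) = s"
| "state Terminal = undefined"

text \<open>
  \<open>merging W V \<mu>\<close>: the nodes of a layer, given by their state values \<open>V\<close>, are merged, and the
  node with value \<open>s\<close> becomes the node with value \<open>\<mu> s\<close>. For \<open>W = None\<close> there is no merging; for
  \<open>W = Some \<omega>\<close> the layer is reduced to at most \<open>\<omega>\<close> nodes.
\<close>

definition merging :: "nat option \<Rightarrow> real set \<Rightarrow> (real \<Rightarrow> real) \<Rightarrow> bool" where
  "merging W V \<mu> \<longleftrightarrow>
     (case W of
        None \<Rightarrow> \<forall>s\<in>V. \<mu> s = s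
      | Some \<omega> \<Rightarrow> (\<exists>Q. partition_on V Q \<and> card Q \<le> \<omega> \<and> (\<forall>M\<in>Q. \<forall>s\<in>M. \<mu> s = Min M)))"

text \<open>
  The value \<open>\<xi>\<close> at node \<open>u\<close> of the layer of variable \<open>v\<close>, for the box with lower and upper
  endpoints \<open>lo\<close> and \<open>hi\<close>, index sets \<open>H k\<close> and rules \<open>\<eta> k\<close>.
\<close>

definition node_bound ::
  "'n::{finite,linorder} set \<Rightarrow> 'n pt \<Rightarrow> 'n pt \<Rightarrow> nat \<Rightarrow> (nat \<Rightarrow> 'n set) \<Rightarrow>
   (nat \<Rightarrow> 'n pt set \<Rightarrow> real) \<Rightarrow> dd_node dd \<Rightarrow> 'n \<Rightarrow> dd_node \<Rightarrow> real" where
  "node_bound C lo hi q H \<eta> D v u =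
     state u +
     (\<Sum>k = 1..q.
        if v = Max (H k)
        then \<eta> k (set_prod (H k)
               (\<lambda>l. if l = v then var_range C v (lo $ v) (hi $ v) else node_range C D u l))
        else 0)"

text \<open>
  \<open>partial_dd \<dots> i D\<close>: \<open>D\<close> is a diagram obtained by building the layers up to layer \<open>i\<close> and the
  arcs between them.
\<close>

inductive partial_dd ::
  "'n::{finite,linorder} set \<Rightarrow> 'n pt \<Rightarrow> 'n pt \<Rightarrow> nat \<Rightarrow> (nat \<Rightarrow> 'n set) \<Rightarrow>
   (nat \<Rightarrow> 'n pt set \<Rightarrow> real) \<Rightarrow> nat option \<Rightarrow> nat \<Rightarrow> dd_node dd \<Rightarrow> bool"
  for C lo hi q H \<eta> W where
  root: "partial_dd C lo hi q H \<eta> W 1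
           \<lparr>layer = (\<lambda>_. {})(1 := {State_Node 1 0}), arcs = \<lambda>_. {#}\<rparr>"
| extend: "\<lbrakk>partial_dd C lo hi q H \<eta> W i D; i < CARD('n); var_index v = i;
            \<xi> = node_bound C lo hi q H \<eta> D v;
            merging W (\<xi> ` layer D i) \<mu>;
            child = (\<lambda>u. State_Node (Suc i) (\<mu> (\<xi> u)))\<rbrakk>
   \<Longrightarrow> partial_dd C lo hi q H \<eta> W (Suc i)
         \<lparr>layer = (layer D)(Suc i := child ` layer D i),
          arcs = (arcs D)(i := \<Sum>u\<in>layer D i. {#(u, lo $ v, child u), (u, hi $ v, child u)#})\<rparr>"

definition relaxed_dd ::
  "'n::{finite,linorder} set \<Rightarrow> 'n pt \<Rightarrow> 'n pt \<Rightarrow> nat \<Rightarrow> (nat \<Rightarrow> 'n set) \<Rightarrow>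
   (nat \<Rightarrow> 'n pt set \<Rightarrow> real) \<Rightarrow> real \<Rightarrow> nat option \<Rightarrow> dd_node dd \<Rightarrow> bool" where
  "relaxed_dd C lo hi q H \<eta> b W D' \<longleftrightarrow>
     (\<exists>D v. partial_dd C lo hi q H \<eta> W CARD('n) D \<and> var_index v = CARD('n) \<and>
        D' = \<lparr>layer = (layer D)(Suc CARD('n) := {Terminal}),
              arcs = (arcs D)(CARD('n) :=
                \<Sum>u\<in>{u \<in> layer D CARD('n). node_bound C lo hi q H \<eta> D v u \<le> b}.
                  {#(u, lo $ v, Terminal), (u, hi $ v, Terminal)#})\<rparr>)"

lemma merging_singleton:
  assumes "merging W {s} \<mu>"
  shows "\<mu> s = s"
proof (cases W)
  case None
  then show ?thesis using assms by (simp add: merging_def)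
next
  case (Some \<omega>)
  then obtain Q where Q: "partition_on {s} Q" "\<forall>M\<in>Q. \<forall>x\<in>M. \<mu> x = Min M"
    using assms by (auto simp: merging_def)
  then obtain M where M: "M \<in> Q" "s \<in> M"
    by (metis UnionE insertI1 partition_on_def)
  with Q(1) have "M = {s}"
    by (auto simp: partition_on_def)
  with Q(2) M show ?thesis by simp
qed

lemma merging_id:
  assumes "\<And>\<omega>. W = Some \<omega> \<Longrightarrow> \<omega> \<ge> 1"
  shows "merging W {s} id"
proof (cases W)
  case None
  then show ?thesis by (simp add: merging_def)
next
  case (Some \<omega>)
  have "partition_on {s} {{s}}" by (simp add: partition_on_def disjoint_def)
  with Some assms[OF Some] show ?thesis
    by (auto simp: merging_def intro!: exI[of _ "{{s}}"])
qed

lemma var_index_bij: "bij_betw var_index (UNIV :: 'n::{finite,linorder} set) {1..CARD('n)}"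
proof -
  have mono: "var_index a < var_index b" if "a < b" for a b :: 'n
    unfolding var_index_def using that by (intro psubset_card_mono) auto
  have inj: "inj (var_index :: 'n \<Rightarrow> nat)"
    by (rule injI) (metis mono less_irrefl neqE)
  have "var_index a \<in> {1..CARD('n)}" for a :: 'n
    unfolding var_index_def
    by (auto simp: Suc_le_eq card_gt_0_iff intro: card_mono)
  then have "range (var_index :: 'n \<Rightarrow> nat) = {1..CARD('n)}"
    by (intro card_subset_eq) (auto simp: card_image inj)
  with inj show ?thesis by (simp add: bij_betw_def)
qed

lemma partial_dd_layers:
  fixes C :: "'n::{finite,linorder} set"
  assumes "partial_dd C lo hi q H \<eta> W i D"
  shows "1 \<le> i \<and> i \<le> CARD('n) \<and>
    (\<exists>s. \<forall>k. layer D k = (if 1 \<le> k \<and> k \<le> i then {State_Node k (s k)} else {})) \<and>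
    (\<forall>k. \<forall>(u, c, v) \<in># arcs D k. 1 \<le> k \<and> k < i \<and> u \<in> layer D k \<and> v \<in> layer D (k + 1))"
  using assms
proof induction
  case root
  show ?case by (auto simp: Suc_le_eq intro!: exI[of _ "\<lambda>_. 0"])
next
  case (extend i D v \<xi> \<mu> child)
  obtain s where s: "\<And>k. layer D k = (if 1 \<le> k \<and> k \<le> i then {State_Node k (s k)} else {})"
    using extend.IH by blast
  have i: "1 \<le> i" using extend.IH by blast
  let ?u = "State_Node i (s i)"
  have Li: "layer D i = {?u}" using s i by simp
  have ch: "child ?u = State_Node (Suc i) (\<mu> (\<xi> ?u))"
    using extend.hyps by simp
  let ?s = "s(Suc i := \<mu> (\<xi> ?u))"
  let ?D = "\<lparr>layer = (layer D)(Suc i := child ` layer D i),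
     arcs = (arcs D)(i := \<Sum>u\<in>layer D i. {#(u, lo $ v, child u), (u, hi $ v, child u)#})\<rparr>"
  have "layer ?D k = (if 1 \<le> k \<and> k \<le> Suc i then {State_Node k (?s k)} else {})" for k
    using s[of k] Li ch by auto
  then have "\<exists>s. \<forall>k. layer ?D k = (if 1 \<le> k \<and> k \<le> Suc i then {State_Node k (s k)} else {})"
    by blast
  moreover have "\<forall>k. \<forall>(u, c, w) \<in># arcs ?D k. 1 \<le> k \<and> k < Suc i \<and> u \<in> layer ?D k \<and> w \<in> layer ?D (k + 1)"
  proof (intro allI ballI, clarify)
    fix k u c w
    assume that: "(u, c, w) \<in># arcs ?D k"
    show "1 \<le> k \<and> k < Suc i \<and> u \<in> layer ?D k \<and> w \<in> layer ?D (k + 1)"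
    proof (cases "k = i")
      case True
      then show ?thesis using that Li i by auto
    next
      case False
      then have "(u, c, w) \<in># arcs D k" using that by simp
      then have "1 \<le> k \<and> k < i \<and> u \<in> layer D k \<and> w \<in> layer D (k + 1)"
        using extend.IH by fastforce
      then show ?thesis by auto
    qed
  qed
  moreover have "1 \<le> Suc i" "Suc i \<le> CARD('n)"
    using \<open>i < CARD('n)\<close> by simp_all
  ultimately show ?case by blast
qed

lemma relaxed_dd_decision_diagram:
  fixes C :: "'n::{finite,linorder} set"
  assumes "relaxed_dd C lo hi q H \<eta> b W D'"
  shows "decision_diagram CARD('n) D'"
proof -
  obtain D v where D: "partial_dd C lo hi q H \<eta> W CARD('n) D"
    and D': "D' = \<lparr>layer = (layer D)(Suc CARD('n) := {Terminal}),
              arcs = (arcs D)(CARD('n) :=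
                \<Sum>u\<in>{u \<in> layer D CARD('n). node_bound C lo hi q H \<eta> D v u \<le> b}.
                  {#(u, lo $ v, Terminal), (u, hi $ v, Terminal)#})\<rparr>"
    using assms unfolding relaxed_dd_def by blast
  obtain s where s: "\<And>k. layer D k =
      (if 1 \<le> k \<and> k \<le> CARD('n) then {State_Node k (s k)} else {})"
    using partial_dd_layers[OF D] by blast
  have ar: "u \<in> layer D k \<and> w \<in> layer D (k + 1)" if "(u, c, w) \<in># arcs D k" for k u c w
    using partial_dd_layers[OF D] that by fastforce
  have L: "layer D' k = (if k = Suc CARD('n) then {Terminal}
      else if 1 \<le> k \<and> k \<le> CARD('n) then {State_Node k (s k)} else {})" for k
    by (simp add: D' s)
  have "u \<in> layer D' i \<and> w \<in> layer D' (i + 1)"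
    if "i \<in> {1..CARD('n)}" "(u, c, w) \<in># arcs D' i" for i u c w
  proof (cases "i = CARD('n)")
    case True
    have "finite {u \<in> layer D CARD('n). node_bound C lo hi q H \<eta> D v u \<le> b}"
      by (simp add: s)
    with True that have "u \<in> layer D CARD('n) \<and> w = Terminal"
      by (auto simp: D' set_mset_sum)
    with True show ?thesis by (simp add: D')
  next
    case False
    then have "u \<in> layer D i \<and> w \<in> layer D (i + 1)"
      using that by (intro ar) (auto simp: D')
    then show ?thesis using that False by (auto simp: D')
  qed
  moreover have "disjoint_family_on (layer D') {1..CARD('n) + 1}"
    by (auto simp: disjoint_family_on_def L)
  moreover have "layer D' 1 = {State_Node 1 (s 1)}"
    by (simp add: L Suc_le_eq)
  moreover have "layer D' (CARD('n) + 1) = {Terminal}"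
    by (simp add: L)
  ultimately show ?thesis
    unfolding decision_diagram_def by blast
qed

lemma relaxed_dd_exists:
  fixes C :: "'n::{finite,linorder} set"
  assumes "\<And>\<omega>. W = Some \<omega> \<Longrightarrow> \<omega> \<ge> 1"
  shows "\<exists>D. relaxed_dd C lo hi q H \<eta> b W D"
proof -
  have var: "\<exists>v::'n. var_index v = i" if "1 \<le> i" "i \<le> CARD('n)" for i
    using var_index_bij[where 'n = 'n] that by (metis atLeastAtMost_iff bij_betw_iff_bijections)
  have "1 \<le> i \<Longrightarrow> i \<le> CARD('n) \<Longrightarrow> \<exists>D. partial_dd C lo hi q H \<eta> W i D" for i
  proof (induction i rule: dec_induct)
    case base
    show ?case using partial_dd.root by blast
  next
    case (step i)
    then obtain D where D: "partial_dd C lo hi q H \<eta> W i D" by auto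
    obtain v :: 'n where v: "var_index v = i" using var[of i] step by auto
    obtain u where u: "layer D i = {u}"
      using partial_dd_layers[OF D] by (metis order_refl)
    show ?case
      using partial_dd.extend[OF D _ v refl _ refl, of id] merging_id[OF assms] step u
      by fastforce
  qed
  moreover have "1 \<le> CARD('n)" by (simp add: Suc_le_eq)
  ultimately obtain D where "partial_dd C lo hi q H \<eta> W CARD('n) D" by blast
  moreover obtain v :: 'n where "var_index v = CARD('n)"
    using var[OF \<open>1 \<le> CARD('n)\<close> order_refl] by blast
  ultimately show ?thesis
    unfolding relaxed_dd_def by blast
qed

end

(*
  With one sub-domain per variable the diagram is a chain whose consecutive nodes are joined by the
  two arcs labelled with the endpoints of the range of that variable. Hence every node domain is the
  full range, the value computed at the last layer is the sum of the bounds of the g_k over the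
  current box, and Sol consists of all vertices of the box if this sum is at most b and is empty
  otherwise. In the first case the convex hull is the continuous box, so it shrinks to the limit
  point together with the boxes. Convergence of the rules makes the sum tend to its value g at the
  limit point, which it never exceeds because the limit point lies in every box; this decides which
  of the two cases occurs.
*)
theory Submission
  imports Defs
begin

section \<open>Hausdorff convergence to a singleton\<close>

text \<open>Any point of the nonempty set bounds the infimum measured from \<open>y\<close>; the
  other supremum is bounded by \<open>r j\<close> directly. An empty set would be at distance
  infinity.\<close>

lemma hausdorff_converges_singletonI:
  assumes ne: "\<And>j. S j \<noteq> {}" and le: "\<And>j x. x \<in> S j \<Longrightarrow> dist x y \<le> r j" and r: "r \<longlonglongrightarrow> 0"
  shows "hausdorff_converges S {y}"
proof -
  have bound: "hausdorff_dist (S j) {y} \<le> ennreal (r j)" for j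
  proof -
    obtain a where a: "a \<in> S j" using ne[of j] by blast
    have "(INF x\<in>S j. ennreal (dist x y)) \<le> ennreal (dist a y)"
      using a by (rule INF_lower)
    also have "\<dots> \<le> ennreal (r j)"
      using le[OF a] by (rule ennreal_leI)
    finally show ?thesis
      by (auto simp: hausdorff_dist_def dist_commute intro!: SUP_least ennreal_leI le)
  qed
  have lim: "(\<lambda>j. ennreal (r j)) \<longlonglongrightarrow> 0"
    using tendsto_ennrealI[OF r] by simp
  show ?thesis
    unfolding hausdorff_converges_def
    by (rule tendsto_sandwich[OF _ _ tendsto_const lim]) (simp_all add: bound)
qed

text \<open>The infimum over a singleton is the distance itself, so every point of
  \<open>S j\<close> is at most the Hausdorff distance away from \<open>y\<close>. This later yields
  the limits of the corners of the boxes.\<close>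

lemma hausdorff_converges_singletonD:
  assumes S: "hausdorff_converges S {y}" and a: "\<And>j. a j \<in> S j"
  shows "a \<longlonglongrightarrow> y"
proof -
  have bound: "ennreal (dist (a j) y) \<le> hausdorff_dist (S j) {y}" for j
    unfolding hausdorff_dist_def using a[of j] by (intro max.coboundedI1 SUP_upper2[of "a j"]) auto
  have "(\<lambda>j. ennreal (dist (a j) y)) \<longlonglongrightarrow> 0"
    by (rule tendsto_sandwich[OF _ _ tendsto_const S[unfolded hausdorff_converges_def]])
      (simp_all add: bound)
  then have "(\<lambda>j. dist (a j) y) \<longlonglongrightarrow> 0"
    by (simp add: tendsto_ennreal_iff flip: ennreal_0)
  then show ?thesis
    by (simp add: tendsto_dist_iff[of a])
qed

section \<open>Boxes and their vertices\<close>

text \<open>In an integer coordinate both endpoints are integers by \<open>box_bounds\<close>, so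
  the intersection with the integers keeps the vertices.\<close>

lemma range_prod_vertex:
  assumes "box_bounds C UNIV lo hi" "\<And>i. x $ i \<in> {lo $ i, hi $ i}"
  shows "x \<in> range_prod C UNIV lo hi"
proof -
  have "x $ i \<in> var_range C i (lo $ i) (hi $ i)" for i
    using assms(1) assms(2)[of i] by (auto simp: box_bounds_def var_range_def)
  then show ?thesis by (simp add: range_prod_def set_prod_def)
qed

lemma range_prod_UNIV_subset_cbox: "range_prod C UNIV lo hi \<subseteq> cbox lo hi"
  by (auto simp: range_prod_def set_prod_def var_range_def mem_box_cart split: if_splits)

text \<open>The corners \<open>lo\<close> and \<open>hi\<close> belong to the smaller box, hence to
  the larger one; their coordinates give the inequalities.\<close>

lemma range_prod_UNIV_mono_imp:
  assumes "box_bounds C UNIV lo hi" "range_prod C UNIV lo hi \<subseteq> range_prod C UNIV lo' hi'"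
  shows "lo' $ i \<le> lo $ i \<and> hi $ i \<le> hi' $ i"
proof -
  have "lo \<in> cbox lo' hi'" "hi \<in> cbox lo' hi'"
    using assms(2) range_prod_vertex[OF assms(1)] range_prod_UNIV_subset_cbox by blast+
  then show ?thesis by (simp add: mem_box_cart)
qed

lemma range_prod_mono:
  assumes "\<And>i. lo' $ i \<le> lo $ i \<and> hi $ i \<le> hi' $ i"
  shows "range_prod C H lo hi \<subseteq> range_prod C H lo' hi'"
proof -
  have "var_range C i (lo $ i) (hi $ i) \<subseteq> var_range C i (lo' $ i) (hi' $ i)" for i
    using assms[of i] by (auto simp: var_range_def)
  then show ?thesis unfolding range_prod_def set_prod_def by blast
qed

lemma subvec_mem_range_prod:
  assumes "x \<in> range_prod C UNIV lo hi"
  shows "subvec H x \<in> range_prod C H lo hi"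
  using assms by (auto simp: range_prod_def set_prod_def subvec_def)

text \<open>Both points vanish outside \<open>H\<close> and lie in the same range inside it; the
  Euclidean norm is at most the sum of the coordinate differences. The bound runs over all indices,
  so that one radius serves every \<open>H\<close>.\<close>

lemma dist_subvec_le:
  assumes "x \<in> range_prod C H lo hi" "y \<in> cbox lo hi"
  shows "dist x (subvec H y) \<le> (\<Sum>i\<in>UNIV. hi $ i - lo $ i)"
proof -
  have "\<bar>(x - subvec H y) $ i\<bar> \<le> hi $ i - lo $ i" for i
  proof -
    have y: "lo $ i \<le> y $ i" "y $ i \<le> hi $ i" using assms(2) by (auto simp: mem_box_cart)
    show ?thesis
    proof (cases "i \<in> H")
      case True
      then have "x $ i \<in> {lo $ i..hi $ i}"
        using assms(1) by (auto simp: range_prod_def set_prod_def var_range_def split: if_splits)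
      with True y show ?thesis by (auto simp: subvec_def)
    next
      case False
      then show ?thesis using assms(1) y by (auto simp: range_prod_def set_prod_def subvec_def)
    qed
  qed
  then show ?thesis
    unfolding dist_norm by (intro order_trans[OF norm_le_l1_cart] sum_mono)
qed

lemma dist_cbox_le:
  fixes x y lo hi :: "real ^ 'n"
  assumes "x \<in> cbox lo hi" "y \<in> cbox lo hi"
  shows "dist x y \<le> (\<Sum>i\<in>UNIV. hi $ i - lo $ i)"
proof -
  have "\<bar>(x - y) $ i\<bar> \<le> hi $ i - lo $ i" for i
    using assms[unfolded mem_box_cart, THEN spec[of _ i]] by auto
  then show ?thesis
    unfolding dist_norm by (intro order_trans[OF norm_le_l1_cart] sum_mono)
qed

lemma extreme_point_of_cbox_vertex:
  fixes x lo hi :: "real ^ 'n"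
  assumes "x extreme_point_of cbox lo hi"
  shows "x $ i \<in> {lo $ i, hi $ i}"
proof (rule ccontr)
  assume ne: "x $ i \<notin> {lo $ i, hi $ i}"
  have x: "x \<in> cbox lo hi" using assms by (simp add: extreme_point_of_def)
  then have "lo $ i \<le> x $ i" "x $ i \<le> hi $ i" by (simp_all add: mem_box_cart)
  with ne have lt: "lo $ i < x $ i" "x $ i < hi $ i" by auto
  \<comment> \<open>Distance to the nearer endpoint: shifting coordinate \<open>i\<close> by
    \<open>e\<close> either way stays in the box, and \<open>x\<close> is the midpoint of the two
    shifted points.\<close>
  define e where "e = min (x $ i - lo $ i) (hi $ i - x $ i)"
  have e: "e > 0" "e \<le> x $ i - lo $ i" "e \<le> hi $ i - x $ i" using lt by (auto simp: e_def)
  let ?a = "x - axis i e" and ?b = "x + axis i e"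
  have "?a \<in> cbox lo hi" "?b \<in> cbox lo hi"
    using x e by (auto simp: mem_box_cart axis_def)
  moreover have "?a \<noteq> ?b"
  proof
    assume "?a = ?b"
    then have "?a $ i = ?b $ i" by (rule arg_cong)
    then have "x $ i - e = x $ i + e"
      unfolding vector_minus_component vector_add_component by (simp add: axis_def)
    with e(1) show False by simp
  qed
  moreover have "midpoint ?a ?b = x"
    by (simp add: midpoint_def vec_eq_iff)
  ultimately show False
    using assms midpoint_in_open_segment[of ?a ?b] by (auto simp: extreme_point_of_def)
qed

text \<open>A compact convex set is the hull of its extreme points (Krein-Milman), and the extreme
  points of a box are vertices.\<close>

lemma convex_hull_cbox_vertices:
  fixes lo hi :: "real ^ 'n"
  assumes "\<And>i. lo $ i \<le> hi $ i"
  shows "convex hull {x. \<forall>i. x $ i \<in> {lo $ i, hi $ i}} = cbox lo hi"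
proof
  show "convex hull {x. \<forall>i. x $ i \<in> {lo $ i, hi $ i}} \<subseteq> cbox lo hi"
  proof (intro hull_minimal convex_box subsetI)
    fix x assume x: "x \<in> {x. \<forall>i. x $ i \<in> {lo $ i, hi $ i}}"
    have "lo $ i \<le> x $ i \<and> x $ i \<le> hi $ i" for i
      using x[simplified, rule_format, of i] assms[of i] by auto
    then show "x \<in> cbox lo hi" by (simp add: mem_box_cart)
  qed
  have "cbox lo hi = convex hull {x. x extreme_point_of cbox lo hi}"
    by (rule Krein_Milman_Minkowski) (auto simp: convex_box)
  also have "\<dots> \<subseteq> convex hull {x. \<forall>i. x $ i \<in> {lo $ i, hi $ i}}"
    using extreme_point_of_cbox_vertex by (intro hull_mono) blast
  finally show "cbox lo hi \<subseteq> convex hull {x. \<forall>i. x $ i \<in> {lo $ i, hi $ i}}" .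
qed

section \<open>Chain diagrams\<close>

lemma var_index_le_iff: "var_index a \<le> var_index b \<longleftrightarrow> a \<le> (b :: 'n::{finite,linorder})"
proof
  assume le: "var_index a \<le> var_index b"
  show "a \<le> b"
  proof (rule ccontr)
    assume "\<not> a \<le> b"
    then have "{..b} \<subset> {..a}" by auto
    then have "var_index b < var_index a"
      unfolding var_index_def by (intro psubset_card_mono) auto
    with le show False by simp
  qed
qed (auto simp: var_index_def intro: card_mono)

lemma var_index_less_iff: "var_index a < var_index b \<longleftrightarrow> a < (b :: 'n::{finite,linorder})"
  by (metis var_index_le_iff linorder_not_le)

lemma var_index_eq_iff [simp]: "var_index a = var_index b \<longleftrightarrow> a = (b :: 'n::{finite,linorder})"
  by (metis var_index_le_iff order.antisym order.refl)

lemma var_index_bounds: "1 \<le> var_index (v :: 'n::{finite,linorder})" "var_index v \<le> CARD('n)"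
  using bij_betwE[OF var_index_bij, rule_format, of v] by auto

lemma var_index_surj:
  assumes "1 \<le> k" "k \<le> CARD('n::{finite,linorder})"
  shows "\<exists>v :: 'n. var_index v = k"
  using var_index_bij[where 'n = 'n] assms by (metis atLeastAtMost_iff bij_betw_iff_bijections)

text \<open>Only the support of each arc multiset is fixed, since paths do not see multiplicities.
  An arc layer that has not been built is expressed by an empty \<open>L k\<close>.\<close>

definition chain_dd :: "(nat \<Rightarrow> 'v) \<Rightarrow> (nat \<Rightarrow> real set) \<Rightarrow> 'v dd \<Rightarrow> bool" where
  "chain_dd node L D \<longleftrightarrow> layer D 1 = {node 1} \<and>
     (\<forall>k. set_mset (arcs D k) = {node k} \<times> L k \<times> {node (Suc k)})"

lemma chain_dd_path_iff:
  assumes "chain_dd node L D"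
  shows "dd_path D k (node k) as w \<longleftrightarrow> w = node (k + length as) \<and>
    (\<forall>j<length as. as ! j \<in> {node (k + j)} \<times> L (k + j) \<times> {node (Suc (k + j))})"
proof (induction as arbitrary: k)
  case (Cons e as)
  obtain a c a' where e: "e = (a, c, a')" by (cases e)
  have "e \<in># arcs D k \<longleftrightarrow> e \<in> {node k} \<times> L k \<times> {node (Suc k)}"
    using assms by (auto simp: chain_dd_def)
  then have "dd_path D k (node k) (e # as) w \<longleftrightarrow>
      e \<in> {node k} \<times> L k \<times> {node (Suc k)} \<and> dd_path D (Suc k) (node (Suc k)) as w"
    by (auto simp: e)
  also have "\<dots> \<longleftrightarrow> w = node (k + length (e # as)) \<and>
    (\<forall>j<length (e # as). (e # as) ! j \<in> {node (k + j)} \<times> L (k + j) \<times> {node (Suc (k + j))})"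
    unfolding Cons.IH All_less_Suc2 by (auto simp: All_less_Suc2)
  finally show ?case .
qed auto

lemma chain_root_path_iff:
  assumes "chain_dd node L D"
  shows "root_path D as w \<longleftrightarrow> w = node (Suc (length as)) \<and>
    (\<forall>j<length as. as ! j \<in> {node (Suc j)} \<times> L (Suc j) \<times> {node (Suc (Suc j))})"
proof -
  have "root_path D as w \<longleftrightarrow> dd_path D 1 (node 1) as w"
    using assms by (simp add: root_path_def chain_dd_def)
  then show ?thesis by (simp add: chain_dd_path_iff[OF assms])
qed

lemma chain_path_label_mem:
  assumes "chain_dd node L D" "root_path D as w" "1 \<le> k" "k \<le> length as"
  shows "path_label as k \<in> L k"
proof -
  have "k - 1 < length as" using assms(3,4) by simp
  then have "as ! (k - 1) \<in> {node (Suc (k - 1))} \<times> L (Suc (k - 1)) \<times> {node (Suc (Suc (k - 1)))}"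
    using assms(2) unfolding chain_root_path_iff[OF assms(1)] by blast
  then show ?thesis using assms(3) by (auto simp: path_label_def)
qed

text \<open>All arcs of a layer share tail and head, so labels can be chosen independently in each
  layer.\<close>

lemma chain_root_path_exists:
  assumes "chain_dd node L D" "\<And>k. 1 \<le> k \<Longrightarrow> k \<le> m \<Longrightarrow> c k \<in> L k"
  obtains as where "root_path D as (node (Suc m))" "length as = m"
    "\<And>k. 1 \<le> k \<Longrightarrow> k \<le> m \<Longrightarrow> path_label as k = c k"
proof
  let ?as = "map (\<lambda>j. (node (Suc j), c (Suc j), node (Suc (Suc j)))) [0..<m]"
  show "root_path D ?as (node (Suc m))"
    using assms(2) by (simp add: chain_root_path_iff[OF assms(1)])
  show "length ?as = m" by simp
  show "path_label ?as k = c k" if "1 \<le> k" "k \<le> m" for k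
  proof -
    have "k - 1 < m" using that by simp
    then show ?thesis using that by (simp add: path_label_def)
  qed
qed

text \<open>Here \<open>m\<close> is the last node layer built, so arcs exist only in layers below
  \<open>m\<close>. The existential makes the set empty at numbers that are not the position of a
  variable, such as 0.\<close>

definition end_labels :: "'n::{finite,linorder} pt \<Rightarrow> 'n pt \<Rightarrow> nat \<Rightarrow> nat \<Rightarrow> real set" where
  "end_labels lo hi m k = {x. \<exists>v. var_index v = k \<and> k < m \<and> x \<in> {lo $ v, hi $ v}}"

lemma end_labels_var_index:
  "end_labels lo hi m (var_index v) = (if var_index v < m then {lo $ v, hi $ v} else {})"
  by (auto simp: end_labels_def)

text \<open>Paths to the node carry only the two endpoints in the layer of \<open>l\<close>, and
  each endpoint is attained, so \<open>Min\<close> and \<open>Max\<close> recover the full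
  range.\<close>

lemma chain_node_range:
  fixes lo hi :: "'n::{finite,linorder} pt"
  assumes D: "chain_dd (\<lambda>k. State_Node k (s k)) (end_labels lo hi i) D"
    and le: "lo $ l \<le> hi $ l" and l: "var_index l < i" and i: "i \<le> Suc CARD('n)"
  shows "node_range C D (State_Node i (s i)) l = var_range C l (lo $ l) (hi $ l)"
proof -
  let ?L = "{path_label as (var_index l) |as.
    root_path D as (State_Node i (s i)) \<and> var_index l \<le> length as}"
  have "?L \<subseteq> {lo $ l, hi $ l}"
    using chain_path_label_mem[OF D _ var_index_bounds(1)[of l]] l
    by (fastforce simp: end_labels_var_index)
  moreover have "x \<in> ?L" if x: "x \<in> {lo $ l, hi $ l}" for x
  proof -
    \<comment> \<open>Labels of a path through \<open>x\<close>; the choice of the lower endpoint in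
      all other layers is arbitrary.\<close>
    define c where "c k = (if k = var_index l then x else lo $ inv var_index k)" for k
    have c: "c k \<in> end_labels lo hi i k" if k: "1 \<le> k" "k \<le> i - 1" for k
    proof -
      have "k \<le> CARD('n)" using k i by linarith
      then obtain v :: 'n where v: "var_index v = k" using var_index_surj[OF k(1)] by blast
      have "inv var_index k = v"
        unfolding v[symmetric] by (intro inv_f_f injI) simp
      with v x k l show ?thesis
        by (auto simp: c_def end_labels_def)
    qed
    obtain as where "root_path D as (State_Node (Suc (i - 1)) (s (Suc (i - 1))))" "length as = i - 1"
      "\<And>k. 1 \<le> k \<Longrightarrow> k \<le> i - 1 \<Longrightarrow> path_label as k = c k"
      using chain_root_path_exists[OF D, of "i - 1" c] c by blast
    moreover have "path_label as (var_index l) = x"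
      using calculation(3)[of "var_index l"] var_index_bounds(1)[of l] l by (simp add: c_def)
    ultimately show ?thesis using l by force
  qed
  ultimately have "?L = {lo $ l, hi $ l}" by blast
  then show ?thesis
    unfolding node_range_def Let_def using le by (simp add: min_absorb1 max_absorb2)
qed

section \<open>The relaxed diagram of a box\<close>

text \<open>A term is added at \<open>v\<close> exactly when \<open>v\<close> is the largest index
  of \<open>H k\<close>. The other indices of \<open>H k\<close> then precede \<open>v\<close>, so
  their node domains are full ranges and the rule is evaluated on the actual sub-box.\<close>

lemma chain_node_bound:
  fixes lo hi :: "'n::{finite,linorder} pt"
  assumes D: "chain_dd (\<lambda>k. State_Node k (s k)) (end_labels lo hi (var_index v)) D"
    and le: "\<And>l. lo $ l \<le> hi $ l"
    and s: "s (var_index v) =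
      (\<Sum>k = 1..q. if Max (H k) < v then \<eta> k (range_prod C (H k) lo hi) else 0)"
  shows "node_bound C lo hi q H \<eta> D v (State_Node (var_index v) (s (var_index v))) =
    (\<Sum>k = 1..q. if Max (H k) \<le> v then \<eta> k (range_prod C (H k) lo hi) else 0)"
proof -
  let ?u = "State_Node (var_index v) (s (var_index v))"
  have "set_prod (H k) (\<lambda>l. if l = v then var_range C v (lo $ v) (hi $ v) else node_range C D ?u l)
      = range_prod C (H k) lo hi" if v: "v = Max (H k)" for k
  proof -
    have "(if l = v then var_range C v (lo $ v) (hi $ v) else node_range C D ?u l)
        = var_range C l (lo $ l) (hi $ l)" if "l \<in> H k" for l
    proof (cases "l = v")
      case False
      have "l \<le> v" using v that by simp
      with False have "var_index l < var_index v"
        by (simp add: var_index_less_iff)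
      with False chain_node_range[OF D le] show ?thesis
        by (simp add: var_index_bounds le_SucI)
    qed simp
    then show ?thesis by (auto simp: range_prod_def set_prod_def)
  qed
  then show ?thesis
    unfolding node_bound_def state.simps s sum.distrib[symmetric]
    by (intro sum.cong) auto
qed

text \<open>Induction along the construction: the state value in layer \<open>i\<close> accumulates
  the bounds of those terms whose largest index lies before layer \<open>i\<close>.\<close>

lemma partial_dd_chain:
  fixes lo hi :: "'n::{finite,linorder} pt"
  assumes "partial_dd C lo hi q H \<eta> W i D" and le: "\<And>l. lo $ l \<le> hi $ l"
  shows "\<exists>s. (\<forall>k. layer D k = (if 1 \<le> k \<and> k \<le> i then {State_Node k (s k)} else {})) \<and>
    chain_dd (\<lambda>k. State_Node k (s k)) (end_labels lo hi i) D \<and>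
    s i = (\<Sum>k = 1..q. if var_index (Max (H k)) < i then \<eta> k (range_prod C (H k) lo hi) else 0)"
  using assms(1)
proof induction
  case root
  \<comment> \<open>Positions start at 1, so at the root there are no arcs and the accumulated sum
    is 0.\<close>
  have pos: "var_index v \<noteq> 0" for v :: 'n
    using var_index_bounds(1)[of v] by simp
  have "end_labels lo hi (Suc 0) k = {}" for k
  proof (rule equals0I)
    fix x assume "x \<in> end_labels lo hi (Suc 0) k"
    then obtain v :: 'n where "var_index v = k" "k < Suc 0" unfolding end_labels_def by blast
    with pos[of v] show False by simp
  qed
  then show ?case
    by (intro exI[of _ "\<lambda>_. 0"]) (simp add: chain_dd_def pos)
next
  case (extend i D v \<xi> \<mu> child)
  then obtain s where
    IH: "(\<forall>k. layer D k = (if 1 \<le> k \<and> k \<le> i then {State_Node k (s k)} else {})) \<and>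
      chain_dd (\<lambda>k. State_Node k (s k)) (end_labels lo hi i) D \<and>
      s i = (\<Sum>k = 1..q. if var_index (Max (H k)) < i then \<eta> k (range_prod C (H k) lo hi) else 0)"
    by (elim exE)
  note layers = IH[THEN conjunct1, rule_format]
    and chain = IH[THEN conjunct2, THEN conjunct1]
    and s = IH[THEN conjunct2, THEN conjunct2]
  have v: "i = var_index v" using extend.hyps by simp
  have i: "1 \<le> i" using v var_index_bounds(1) by simp
  let ?u = "State_Node i (s i)"
  have Li: "layer D i = {?u}" using layers i by simp
  have \<xi>: "\<xi> ?u =
      (\<Sum>k = 1..q. if Max (H k) \<le> v then \<eta> k (range_prod C (H k) lo hi) else 0)"
    unfolding \<open>\<xi> = _\<close> v using chain le s unfolding v var_index_less_iff by (rule chain_node_bound)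
  \<comment> \<open>The layer has one node, so merging cannot change its state value, whatever
    \<open>W\<close> is.\<close>
  have "merging W {\<xi> ?u} \<mu>" using extend.hyps Li by simp
  then have "\<mu> (\<xi> ?u) = \<xi> ?u" by (rule merging_singleton)
  then have ch: "child ?u = State_Node (Suc i) (\<xi> ?u)"
    using extend.hyps by simp
  let ?s = "s(Suc i := \<xi> ?u)"
  let ?D = "\<lparr>layer = (layer D)(Suc i := child ` layer D i),
     arcs = (arcs D)(i := \<Sum>u\<in>layer D i. {#(u, lo $ v, child u), (u, hi $ v, child u)#})\<rparr>"
  have "layer ?D k = (if 1 \<le> k \<and> k \<le> Suc i then {State_Node k (?s k)} else {})" for k
    using layers[of k] Li ch by auto
  moreover have "chain_dd (\<lambda>k. State_Node k (?s k)) (end_labels lo hi (Suc i)) ?D"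
    unfolding chain_dd_def
  proof (intro conjI allI)
    show "layer ?D 1 = {State_Node 1 (?s 1)}" using layers[of 1] i by simp
    fix k
    show "set_mset (arcs ?D k) =
      {State_Node k (?s k)} \<times> end_labels lo hi (Suc i) k \<times> {State_Node (Suc k) (?s (Suc k))}"
    proof (cases "k = i")
      case True
      have "end_labels lo hi (Suc i) i = {lo $ v, hi $ v}"
        unfolding v end_labels_var_index by simp
      with True Li ch show ?thesis by auto
    next
      case False
      then have "end_labels lo hi (Suc i) k = end_labels lo hi i k"
        by (auto simp: end_labels_def)
      \<comment> \<open>The new state value at \<open>Suc i\<close> affects no arc with tail in that
        layer, because there is none yet.\<close>
      moreover have "end_labels lo hi i k = {}" if "k = Suc i"
        using that by (simp add: end_labels_def)
      ultimately show ?thesis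
        using False chain by (auto simp: chain_dd_def)
    qed
  qed
  moreover have "?s (Suc i) =
      (\<Sum>k = 1..q. if var_index (Max (H k)) < Suc i then \<eta> k (range_prod C (H k) lo hi) else 0)"
    using \<xi> by (simp add: v less_Suc_eq_le var_index_le_iff)
  ultimately show ?case by blast
qed

text \<open>The only test against \<open>b\<close> is made at the single node of the last layer, so
  it keeps all paths or removes all of them.\<close>

lemma Sol_relaxed_dd:
  fixes lo hi :: "'n::{finite,linorder} pt"
  assumes "relaxed_dd C lo hi q H \<eta> b W D'" and le: "\<And>l. lo $ l \<le> hi $ l"
  shows "(Sol D' :: 'n pt set) =
    (if (\<Sum>k = 1..q. \<eta> k (range_prod C (H k) lo hi)) \<le> b
     then {x. \<forall>i. x $ i \<in> {lo $ i, hi $ i}} else {})"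
proof -
  let ?n = "CARD('n)"
  obtain D v where D: "partial_dd C lo hi q H \<eta> W ?n D" and v: "var_index v = ?n"
    and D': "D' = \<lparr>layer = (layer D)(Suc ?n := {Terminal}),
              arcs = (arcs D)(?n :=
                \<Sum>u\<in>{u \<in> layer D ?n. node_bound C lo hi q H \<eta> D v u \<le> b}.
                  {#(u, lo $ v, Terminal), (u, hi $ v, Terminal)#})\<rparr>"
    using assms unfolding relaxed_dd_def by blast
  obtain s where layers: "\<And>k. layer D k = (if 1 \<le> k \<and> k \<le> ?n then {State_Node k (s k)} else {})"
    and chain: "chain_dd (\<lambda>k. State_Node k (s k)) (end_labels lo hi ?n) D"
    and s: "s ?n =
      (\<Sum>k = 1..q. if var_index (Max (H k)) < ?n then \<eta> k (range_prod C (H k) lo hi) else 0)"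
    using partial_dd_chain[OF D le] by blast
  have n: "1 \<le> ?n" by (simp add: Suc_le_eq)
  \<comment> \<open>Since \<open>v\<close> is the last variable, the value at its node includes the
    terms of all \<open>k\<close>.\<close>
  have top: "w \<le> v" for w
    using var_index_bounds(2)[of w] v by (metis var_index_le_iff)
  define bound where "bound = (\<Sum>k = 1..q. \<eta> k (range_prod C (H k) lo hi))"
  have bound: "node_bound C lo hi q H \<eta> D v (State_Node ?n (s ?n)) = bound"
    using chain_node_bound[where s = s and v = v and D = D] chain le s
    unfolding v[symmetric] var_index_less_iff by (simp add: bound_def top)
  \<comment> \<open>The finished diagram is again a chain, with the terminal after layer
    \<open>?n\<close>; a failed test becomes an empty last label set.\<close>
  define node where "node k = (if k \<le> ?n then State_Node k (s k) else Terminal)" for k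
  define L where "L k = (if k = ?n \<and> b < bound then {} else end_labels lo hi (Suc ?n) k)" for k
  have chain': "chain_dd node L D'"
    unfolding chain_dd_def
  proof (intro conjI allI)
    show "layer D' 1 = {node 1}" using n layers[of 1] by (simp add: D' node_def)
    fix k
    show "set_mset (arcs D' k) = {node k} \<times> L k \<times> {node (Suc k)}"
    proof (cases "k = ?n")
      case True
      have filter_singleton: "{u \<in> {a}. f u \<le> b} = (if b < f a then {} else {a})"
        for f :: "dd_node \<Rightarrow> real" and a by auto
      have "layer D ?n = {State_Node ?n (s ?n)}" using layers n by simp
      then have "{u \<in> layer D ?n. node_bound C lo hi q H \<eta> D v u \<le> b}
          = (if b < bound then {} else {State_Node ?n (s ?n)})"
        by (simp only: filter_singleton bound)
      moreover have "end_labels lo hi (Suc ?n) ?n = {lo $ v, hi $ v}"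
        unfolding v[symmetric] end_labels_var_index by simp
      ultimately show ?thesis
        using True by (auto simp: D' node_def L_def)
    next
      case False
      then have "L k = end_labels lo hi ?n k"
        by (auto simp: L_def end_labels_def)
      moreover have "end_labels lo hi ?n k = {}" if "\<not> k < ?n"
        using that by (simp add: end_labels_def)
      ultimately show ?thesis
        using False chain by (auto simp: D' node_def chain_dd_def)
    qed
  qed
  \<comment> \<open>The solutions form the product of the label sets, so a single empty label set
    leaves none.\<close>
  have Sol: "x \<in> Sol D' \<longleftrightarrow> (\<forall>l. x $ l \<in> L (var_index l))" for x :: "'n pt"
  proof
    assume "x \<in> Sol D'"
    then obtain as t where as: "root_path D' as t" "length as = ?n"
      "\<And>l. x $ l = path_label as (var_index l)"
      by (auto simp: Sol_def)
    then show "\<forall>l. x $ l \<in> L (var_index l)"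
      using chain_path_label_mem[OF chain' as(1)] var_index_bounds by auto
  next
    assume x: "\<forall>l. x $ l \<in> L (var_index l)"
    have c: "x $ inv var_index k \<in> L k" if k: "1 \<le> k" "k \<le> ?n" for k
    proof -
      obtain w :: 'n where w: "var_index w = k" using var_index_surj k by blast
      have "inv var_index k = w"
        unfolding w[symmetric] by (intro inv_f_f injI) simp
      with x w show ?thesis by auto
    qed
    obtain as where as: "root_path D' as (node (Suc ?n))" "length as = ?n"
      "\<And>k. 1 \<le> k \<Longrightarrow> k \<le> ?n \<Longrightarrow> path_label as k = x $ inv var_index k"
      using chain_root_path_exists[OF chain', of ?n "\<lambda>k. x $ inv var_index k"] c by blast
    have "x $ l = path_label as (var_index l)" for l
    proof -
      have "inv var_index (var_index l) = l" by (intro inv_f_f injI) simp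
      then show ?thesis using as(3)[of "var_index l"] var_index_bounds[of l] by simp
    qed
    moreover have "node (Suc ?n) \<in> layer D' (?n + 1)" by (simp add: node_def D')
    ultimately show "x \<in> Sol D'"
      using as(1,2) unfolding Sol_def by blast
  qed
  show ?thesis
  proof (cases "bound \<le> b")
    case True
    then have "L (var_index l) = {lo $ l, hi $ l}" for l
      using var_index_bounds(2)[of l] by (auto simp: L_def end_labels_var_index)
    then have "Sol D' = {x. \<forall>i. x $ i \<in> {lo $ i, hi $ i}}"
      unfolding set_eq_iff mem_Collect_eq Sol by simp
    with True show ?thesis unfolding bound_def by simp
  next
    case False
    then have "L (var_index v) = {}" using v by (simp add: L_def)
    then have "x \<notin> Sol D'" for x :: "'n pt" unfolding Sol by blast
    then have "(Sol D' :: 'n pt set) = {}" by blast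
    with False show ?thesis unfolding bound_def by simp
  qed
qed

section \<open>Passage to the limit along the nested boxes\<close>

theorem proposition12:
  fixes C :: "'n::{finite,linorder} set"
    and Plo Phi :: "'n pt"
    and P :: "'n pt set"
    and q :: nat
    and H :: "nat \<Rightarrow> 'n set"
    and gk :: "nat \<Rightarrow> 'n pt \<Rightarrow> real"
    and g :: "'n pt \<Rightarrow> real"
    and b :: real
    and lo hi :: "nat \<Rightarrow> 'n pt"
    and Pj :: "nat \<Rightarrow> 'n pt set"
    and xt :: "'n pt"
    and \<eta> :: "nat \<Rightarrow> 'n pt set \<Rightarrow> real"
    and W :: "nat option"
    and D :: "nat \<Rightarrow> dd_node dd"
  assumes P: "P = range_prod C UNIV Plo Phi"
    and H: "\<And>k. k \<in> {1..q} \<Longrightarrow> H k \<noteq> {}"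
    and g: "\<And>x. x \<in> P \<Longrightarrow> g x = (\<Sum>k = 1..q. gk k (subvec (H k) x))"
    and Pj: "\<And>j. Pj j = range_prod C UNIV (lo j) (hi j)"
    and Pj_box: "\<And>j. box_bounds C UNIV (lo j) (hi j)"
    and Pj_sub: "\<And>j. Pj j \<subseteq> P"
    and Pj_nested: "nested_seq Pj"
    and Pj_conv: "hausdorff_converges Pj {xt}"
    and xt_int: "\<And>i. i \<notin> C \<Longrightarrow> xt $ i \<in> \<int>"
    and rule: "\<And>k. k \<in> {1..q} \<Longrightarrow>
        convergent_rule C (H k) (gk k) (range_prod C (H k) Plo Phi) (\<eta> k)"
    and width: "\<And>\<omega>. W = Some \<omega> \<Longrightarrow> \<omega> \<ge> 1"
    and D: "\<And>j. relaxed_dd C (lo j) (hi j) q H \<eta> b W (D j)"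
  shows "(g xt \<le> b \<longrightarrow>
            nested_seq (\<lambda>j. convex hull (Sol (D j) :: 'n pt set)) \<and>
            hausdorff_converges (\<lambda>j. convex hull (Sol (D j) :: 'n pt set)) {xt}) \<and>
         (g xt > b \<longrightarrow> (\<exists>m. \<forall>j\<ge>m. (Sol (D j) :: 'n pt set) = {}))"
proof -
  have le: "lo j $ i \<le> hi j $ i" for i j
    using Pj_box[of j] by (simp add: box_bounds_def)
  have step: "lo j $ i \<le> lo (Suc j) $ i \<and> hi (Suc j) $ i \<le> hi j $ i" for i j
    using Pj_nested Pj by (intro range_prod_UNIV_mono_imp[OF Pj_box]) (auto simp: nested_seq_def)
  have sub: "Plo $ i \<le> lo j $ i \<and> hi j $ i \<le> Phi $ i" for i j
    using Pj_sub[of j] by (intro range_prod_UNIV_mono_imp[OF Pj_box]) (simp add: P Pj)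
  \<comment> \<open>The two corners are points of \<open>Pj j\<close>, so they follow the sets to
    the limit.\<close>
  have lim: "lo \<longlonglongrightarrow> xt" "hi \<longlonglongrightarrow> xt"
    using Pj range_prod_vertex[OF Pj_box] by (auto intro!: hausdorff_converges_singletonD[OF Pj_conv])
  \<comment> \<open>Lower endpoints increase and upper endpoints decrease to the same limit, which
    is therefore enclosed at every stage.\<close>
  have xt: "lo j $ i \<le> xt $ i \<and> xt $ i \<le> hi j $ i" for i j
  proof
    have "incseq (\<lambda>j. lo j $ i)" "decseq (\<lambda>j. hi j $ i)"
      using step by (auto intro: incseq_SucI decseq_SucI)
    then show "lo j $ i \<le> xt $ i" "xt $ i \<le> hi j $ i"
      using tendsto_vec_nth[OF lim(1)] tendsto_vec_nth[OF lim(2)] incseq_le decseq_ge by blast+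
  qed
  then have xt_cbox: "xt \<in> cbox (lo j) (hi j)" for j
    by (simp add: mem_box_cart)
  \<comment> \<open>Integrality of \<open>xt\<close> enters here: it lifts membership from the
    continuous box to \<open>Pj j\<close>.\<close>
  have xt_Pj: "xt \<in> range_prod C UNIV (lo j) (hi j)" for j
    using xt xt_int by (auto simp: range_prod_def set_prod_def var_range_def)
  \<comment> \<open>Total width of the box, the common radius for the sub-boxes and the convex
    hulls.\<close>
  define r where "r j = (\<Sum>i\<in>UNIV. hi j $ i - lo j $ i)" for j
  have r: "r \<longlonglongrightarrow> 0"
  proof -
    have "r \<longlonglongrightarrow> (\<Sum>i\<in>UNIV. xt $ i - xt $ i)"
      unfolding r_def by (intro tendsto_intros lim)
    then show ?thesis by simp
  qed
  define B where "B k j = range_prod C (H k) (lo j) (hi j)" for k j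
  \<comment> \<open>The value that is compared with \<open>b\<close> in the last layer of
    \<open>D j\<close>.\<close>
  define \<beta> where "\<beta> j = (\<Sum>k = 1..q. \<eta> k (B k j))" for j
  have B_box: "is_box C (H k) (B k j)" for k j
    unfolding is_box_def B_def using Pj_box[of j]
    by (intro exI[of _ "lo j"] exI[of _ "hi j"]) (simp add: box_bounds_def)
  have B_sub: "B k j \<subseteq> range_prod C (H k) Plo Phi" for k j
    unfolding B_def using sub by (intro range_prod_mono) blast
  have B_xt: "subvec (H k) xt \<in> B k j" for k j
    unfolding B_def by (rule subvec_mem_range_prod[OF xt_Pj])
  have g_xt: "g xt = (\<Sum>k = 1..q. gk k (subvec (H k) xt))"
    using xt_Pj[of 0] Pj_sub[of 0] Pj by (intro g) auto
  have \<beta>_le: "\<beta> j \<le> g xt" for j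
    unfolding \<beta>_def g_xt
    using rule B_box B_sub B_xt
    by (intro sum_mono) (simp add: convergent_rule_def consistent_rule_def lower_bound_rule_def)
  have \<beta>_lim: "\<beta> \<longlonglongrightarrow> g xt"
    unfolding \<beta>_def g_xt
  \<comment> \<open>For each \<open>k\<close> the sub-boxes are nested and shrink to the sub-vector
    of \<open>xt\<close>, so convergence of the rule applies termwise.\<close>
  proof (intro tendsto_sum)
    fix k assume k: "k \<in> {1..q}"
    have "nested_seq (B k)"
      unfolding nested_seq_def B_def using step by (intro allI range_prod_mono) blast
    moreover have "hausdorff_converges (B k) {subvec (H k) xt}"
    proof (rule hausdorff_converges_singletonI[OF _ _ r])
      show "B k j \<noteq> {}" for j using B_xt by blast
      show "dist x (subvec (H k) xt) \<le> r j" if "x \<in> B k j" for j x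
        using dist_subvec_le[OF _ xt_cbox] that by (simp add: B_def r_def)
    qed
    ultimately show "(\<lambda>j. \<eta> k (B k j)) \<longlonglongrightarrow> gk k (subvec (H k) xt)"
      using B_box B_sub
      by (intro rule[OF k, unfolded convergent_rule_def, THEN conjunct2, rule_format]) simp
  qed
  have Sol: "(Sol (D j) :: 'n pt set) =
      (if \<beta> j \<le> b then {x. \<forall>i. x $ i \<in> {lo j $ i, hi j $ i}} else {})" for j
    unfolding \<beta>_def B_def by (rule Sol_relaxed_dd[OF D le])
  show ?thesis
  proof (intro conjI impI)
    assume "g xt \<le> b"
    \<comment> \<open>The lower bound property gives this for every \<open>j\<close>, not only
      eventually, so each hull is the whole continuous box.\<close>
    then have "\<beta> j \<le> b" for j using \<beta>_le order_trans by blast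
    then have hull: "convex hull (Sol (D j) :: 'n pt set) = cbox (lo j) (hi j)" for j
      using convex_hull_cbox_vertices[OF le] by (simp add: Sol)
    show "nested_seq (\<lambda>j. convex hull (Sol (D j) :: 'n pt set))"
      unfolding nested_seq_def hull subset_iff mem_box_cart using step order_trans by metis
    show "hausdorff_converges (\<lambda>j. convex hull (Sol (D j) :: 'n pt set)) {xt}"
      unfolding hull
    proof (rule hausdorff_converges_singletonI[OF _ _ r])
      show "cbox (lo j) (hi j) \<noteq> {}" for j using xt_cbox by blast
      show "dist x xt \<le> r j" if "x \<in> cbox (lo j) (hi j)" for j x
        using dist_cbox_le[OF that xt_cbox] by (simp add: r_def)
    qed
  next
    assume "g xt > b"
    \<comment> \<open>A strict inequality at the limit of \<open>\<beta>\<close> holds from some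
      index on, and then the test fails.\<close>
    then have "\<forall>\<^sub>F j in sequentially. \<beta> j > b"
      by (rule order_tendstoD(1)[OF \<beta>_lim])
    then have "\<forall>\<^sub>F j in sequentially. (Sol (D j) :: 'n pt set) = {}"
      by eventually_elim (simp add: Sol)
    then show "\<exists>m. \<forall>j\<ge>m. (Sol (D j) :: 'n pt set) = {}"
      by (simp add: eventually_sequentially)
  qed
qed

end
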